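(* Let $(G,\tau)$ be a locally solid $\ell$-group in which every singleton is bounded. Then unbounded $\tau$-convergence on $G$ is the convergence of a topology $u\tau$ on $G$, and $(G,u\tau)$ is again a locally solid $\ell$-group. If $\tau$ is Hausdorff, then so is $u\tau$.
   Context: All groups are abelian and written additively. An $\ell$-group is a group that is also a lattice under a translation-invariant partial order; $|x|=x\vee(-x)$. A topological $\ell$-group is a topological group that is an $\ell$-group with continuous lattice operations. A set $S\subseteq G$ is solid if $x\in G$, $y\in S$, $|x|\le|y|$ imply $x\in S$. A topological $\ell$-group is locally solid if its topology has a local basis at the identity consisting of solid neighborhoods. A subset $B$ of $G$ is bounded if for each neighborhood $U$ of the identity there is a positive integer $n$ with $B\subseteq nU$, where $nU=\{x_1+\dots+x_n: x_i\in U\}$. A net $(x_\alpha)$ in a topological $\ell$-group $(G,\tau)$ is unbounded $\tau$-convergent to $x\in G$, written $x_\alpha\xrightarrow{u\tau}x$, if $|x_\alpha-x|\wedge u\xrightarrow{\tau}0$ for each positive $u\in G$. *)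

theory Defs
  imports "HOL-Analysis.Analysis" "HOL-Library.Lattice_Algebras"
begin

text \<open>
  An abelian l-group is a type of class \<^class>\<open>lattice_ab_group_add_abs\<close>
  (so that \<open>\<bar>x\<bar> = sup x (- x)\<close>).  Two topologies on the same group have to be compared, hence
  topologies are values of type \<open>'a topology\<close> rather than type class instances.
\<close>

definition topological_lgroup :: "'a::lattice_ab_group_add_abs topology \<Rightarrow> bool" where
  "topological_lgroup T \<longleftrightarrow>
     topspace T = UNIV \<and>
     continuous_map (prod_topology T T) T (\<lambda>(x, y). x + y) \<and>
     continuous_map T T (\<lambda>x. - x) \<and>
     continuous_map (prod_topology T T) T (\<lambda>(x, y). sup x y) \<and>
     continuous_map (prod_topology T T) T (\<lambda>(x, y). inf x y)"

definition solid :: "'a::lattice_ab_group_add_abs set \<Rightarrow> bool" where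
  "solid S \<longleftrightarrow> (\<forall>x. \<forall>y\<in>S. \<bar>x\<bar> \<le> \<bar>y\<bar> \<longrightarrow> x \<in> S)"

definition locally_solid_lgroup :: "'a::lattice_ab_group_add_abs topology \<Rightarrow> bool" where
  "locally_solid_lgroup T \<longleftrightarrow> topological_lgroup T \<and> neighbourhood_base_at 0 solid T"

definition nfold_sumset :: "nat \<Rightarrow> 'a::ab_group_add set \<Rightarrow> 'a set" where
  "nfold_sumset n U = {\<Sum>i<n. x i | x. \<forall>i<n. x i \<in> U}"

definition group_bounded :: "'a::ab_group_add topology \<Rightarrow> 'a set \<Rightarrow> bool" where
  "group_bounded T B \<longleftrightarrow>
     (\<forall>U. (\<exists>W. openin T W \<and> 0 \<in> W \<and> W \<subseteq> U) \<longrightarrow> (\<exists>n>0. B \<subseteq> nfold_sumset n U))"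

definition directed_set :: "'i set \<Rightarrow> ('i \<Rightarrow> 'i \<Rightarrow> bool) \<Rightarrow> bool" where
  "directed_set I le \<longleftrightarrow>
     I \<noteq> {} \<and>
     (\<forall>i\<in>I. le i i) \<and>
     (\<forall>i\<in>I. \<forall>j\<in>I. \<forall>k\<in>I. le i j \<longrightarrow> le j k \<longrightarrow> le i k) \<and>
     (\<forall>i\<in>I. \<forall>j\<in>I. \<exists>k\<in>I. le i k \<and> le j k)"

text \<open>The filter of tails of a directed set: a net indexed by \<open>I\<close> converges iff it converges
  along this filter.\<close>

definition net_filter :: "'i set \<Rightarrow> ('i \<Rightarrow> 'i \<Rightarrow> bool) \<Rightarrow> 'i filter" where
  "net_filter I le = (INF i\<in>I. principal {j \<in> I. le i j})"

lemma eventually_net_filter: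
  assumes "directed_set I le"
  shows "eventually P (net_filter I le) \<longleftrightarrow> (\<exists>i\<in>I. \<forall>j\<in>I. le i j \<longrightarrow> P j)"
  unfolding net_filter_def
proof (subst eventually_INF_base)
  show "I \<noteq> {}"
    using assms by (simp add: directed_set_def)
next
  fix a b assume "a \<in> I" "b \<in> I"
  then obtain k where k: "k \<in> I" "le a k" "le b k"
    using assms unfolding directed_set_def by metis
  have "le a j \<and> le b j" if "j \<in> I" "le k j" for j
    using assms k that \<open>a \<in> I\<close> \<open>b \<in> I\<close> unfolding directed_set_def by metis
  with k(1) show "\<exists>x\<in>I. principal {j \<in> I. le x j}
      \<le> inf (principal {j \<in> I. le a j}) (principal {j \<in> I. le b j})"
    by (intro bexI[of _ k]) auto
qed (auto simp: eventually_principal)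

text \<open>Unbounded \<open>T\<close>-convergence of \<open>f\<close> to \<open>x\<close> along \<open>F\<close>, with the argument order of
  \<^const>\<open>limitin\<close>.  Positive means \<open>0 \<le> u\<close>; the value \<open>u = 0\<close> imposes no condition.\<close>

definition unbounded_limitin ::
    "'a::lattice_ab_group_add_abs topology \<Rightarrow> ('i \<Rightarrow> 'a) \<Rightarrow> 'a \<Rightarrow> 'i filter \<Rightarrow> bool" where
  "unbounded_limitin T f x F \<longleftrightarrow> (\<forall>u\<ge>0. limitin T (\<lambda>i. inf \<bar>f i - x\<bar> u) 0 F)"

text \<open>\<open>U\<close> is a topology whose convergence is unbounded \<open>T\<close>-convergence.  The nets in the first
  clause have indices in the type \<open>'i\<close>, on which a single \<open>U\<close> must not depend.  The convergence of
  a net depends only on its image filter on the group, so the second clause, over the filters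
  on \<open>'a\<close>, expresses the equivalence for nets over all index types at once.\<close>

definition unbounded_convergence_topology ::
    "'i itself \<Rightarrow> 'a::lattice_ab_group_add_abs topology \<Rightarrow> 'a topology \<Rightarrow> bool" where
  "unbounded_convergence_topology (_ :: 'i itself) T U \<longleftrightarrow>
     (\<forall>I le (f :: 'i \<Rightarrow> 'a) x. directed_set I le \<longrightarrow>
        (limitin U f x (net_filter I le) \<longleftrightarrow> unbounded_limitin T f x (net_filter I le))) \<and>
     (\<forall>(F :: 'a filter) x. limitin U id x F \<longleftrightarrow> unbounded_limitin T id x F)"

end

(*
  The sets {x. inf |x| u \<in> V}, for solid \<tau>-neighbourhoods V of 0 and u \<ge> 0, are solid and directed
  downwards, and since inf |x + y| u \<le> inf |x| u + inf |y| u, each contains the sumset W + W of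
  another.  Any such family is a base at 0 of a locally solid group topology: addition, sup and inf
  all satisfy |g x y - g a b| \<le> |x - a| + |y - b|, so they are continuous.  Convergence in this
  topology is unbounded \<tau>-convergence by the choice of the base.  If \<tau> is Hausdorff and x \<noteq> 0,
  then u = |x| and a V that omits |x| separate x from 0.
*)

theory Submission
  imports Defs
begin

section \<open>Inequalities in abelian lattice-ordered groups\<close>

lemma inf_abs_add_le:
  fixes x y u :: "'a::lattice_ab_group_add_abs"
  assumes "0 \<le> u"
  shows "inf \<bar>x + y\<bar> u \<le> inf \<bar>x\<bar> u + inf \<bar>y\<bar> u"
proof -
  \<comment> \<open>Addition distributes over \<open>inf\<close>, so the right-hand side is the
    infimum of the four sums bounded below here. The first bound is the triangle inequality; the
    other three sums are at least \<open>u\<close>, because \<open>0 \<le> u\<close>.\<close>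
  have "inf \<bar>x + y\<bar> u \<le> \<bar>x\<bar> + \<bar>y\<bar>"
    using abs_triangle_ineq by (rule le_infI1)
  moreover have "inf \<bar>x + y\<bar> u \<le> u + \<bar>y\<bar>" "inf \<bar>x + y\<bar> u \<le> \<bar>x\<bar> + u" "inf \<bar>x + y\<bar> u \<le> u + u"
    using assms by (auto intro!: le_infI2 simp: add_increasing add_increasing2)
  ultimately show ?thesis
    by (simp add: add_inf_distrib_left add_inf_distrib_right)
qed

lemma le_add_abs_diff:
  fixes x a :: "'a::lattice_ab_group_add_abs"
  shows "x \<le> a + \<bar>x - a\<bar>"
  using abs_ge_self[of "x - a"] by (simp add: diff_le_eq add.commute)

text \<open>Both \<open>x\<close> and \<open>y\<close> lie below \<open>sup a b\<close> plus the
  total error, which bounds the difference from above. Exchanging the two pairs leaves the error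
  unchanged, so the same estimate bounds it from below.\<close>

lemma abs_sup_diff_le:
  fixes x y a b :: "'a::lattice_ab_group_add_abs"
  shows "\<bar>sup x y - sup a b\<bar> \<le> \<bar>x - a\<bar> + \<bar>y - b\<bar>"
proof -
  have le: "sup x y \<le> sup a b + (\<bar>x - a\<bar> + \<bar>y - b\<bar>)" for x y a b :: 'a
  proof (rule sup_least)
    have "x \<le> a + \<bar>x - a\<bar>" by (rule le_add_abs_diff)
    also have "\<dots> \<le> sup a b + (\<bar>x - a\<bar> + \<bar>y - b\<bar>)"
      by (intro add_mono) auto
    finally show "x \<le> sup a b + (\<bar>x - a\<bar> + \<bar>y - b\<bar>)" .
    have "y \<le> b + \<bar>y - b\<bar>" by (rule le_add_abs_diff)
    also have "\<dots> \<le> sup a b + (\<bar>x - a\<bar> + \<bar>y - b\<bar>)"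
      by (intro add_mono) auto
    finally show "y \<le> sup a b + (\<bar>x - a\<bar> + \<bar>y - b\<bar>)" .
  qed
  show ?thesis
    using le[of x y a b] le[of a b x y]
    by (intro abs_leI; unfold minus_diff_eq diff_le_eq)
      (simp_all only: add.commute abs_minus_commute[of a x] abs_minus_commute[of b y])
qed

text \<open>Negation turns \<open>inf\<close> into \<open>sup\<close> and preserves the absolute
  values of differences, so the estimate for \<open>sup\<close> carries over.\<close>

lemma abs_inf_diff_le:
  fixes x y a b :: "'a::lattice_ab_group_add_abs"
  shows "\<bar>inf x y - inf a b\<bar> \<le> \<bar>x - a\<bar> + \<bar>y - b\<bar>"
proof -
  have "inf x y - inf a b = sup (- a) (- b) - sup (- x) (- y)"
    by (simp only: inf_eq_neg_sup[of x y] inf_eq_neg_sup[of a b] diff_minus_eq_add uminus_add_conv_diff)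
  then show ?thesis
    using abs_sup_diff_le[of "- a" "- b" "- x" "- y"]
    by (simp only: minus_diff_minus abs_minus_commute[of x a] abs_minus_commute[of y b]
        abs_minus_cancel)
qed

lemma solidD: "solid S \<Longrightarrow> y \<in> S \<Longrightarrow> \<bar>x\<bar> \<le> \<bar>y\<bar> \<Longrightarrow> x \<in> S"
  unfolding solid_def by blast

section \<open>Group topologies generated by a base of solid sets\<close>

definition translation_topology :: "'a::ab_group_add set set \<Rightarrow> 'a topology" where
  "translation_topology N = topology (\<lambda>U. \<forall>x\<in>U. \<exists>V\<in>N. \<forall>y. y - x \<in> V \<longrightarrow> y \<in> U)"

text \<open>These are the usual axioms for a neighbourhood base at 0 of a group topology. Symmetry
  of the members is not listed, because solid sets are symmetric. The members need not be
  open.\<close>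

locale solid_base =
  fixes N :: "'a::lattice_ab_group_add_abs set set"
  assumes nonempty: "N \<noteq> {}"
    and zero_mem: "V \<in> N \<Longrightarrow> 0 \<in> V"
    and solid: "V \<in> N \<Longrightarrow> solid V"
    and directed: "V \<in> N \<Longrightarrow> W \<in> N \<Longrightarrow> \<exists>X\<in>N. X \<subseteq> V \<inter> W"
    and halving: "V \<in> N \<Longrightarrow> \<exists>W\<in>N. \<forall>x\<in>W. \<forall>y\<in>W. x + y \<in> V"
begin

abbreviation T where "T \<equiv> translation_topology N"

text \<open>The constructor \<open>topology\<close> returns the intended open sets once
  \<open>istopology\<close> is known. Binary intersections are handled by \<open>directed\<close>;
  for unions the witness of any one member serves.\<close>

lemma openin_iff: "openin T U \<longleftrightarrow> (\<forall>x\<in>U. \<exists>V\<in>N. \<forall>y. y - x \<in> V \<longrightarrow> y \<in> U)"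
proof -
  have "istopology (\<lambda>U. \<forall>x\<in>U. \<exists>V\<in>N. \<forall>y. y - x \<in> V \<longrightarrow> y \<in> U)"
    unfolding istopology_def
  proof (intro conjI allI impI ballI)
    fix A B x
    assume A: "\<forall>x\<in>A. \<exists>V\<in>N. \<forall>y. y - x \<in> V \<longrightarrow> y \<in> A"
      and B: "\<forall>x\<in>B. \<exists>V\<in>N. \<forall>y. y - x \<in> V \<longrightarrow> y \<in> B"
      and x: "x \<in> A \<inter> B"
    obtain V where V: "V \<in> N" "\<forall>y. y - x \<in> V \<longrightarrow> y \<in> A" using A x by (meson IntD1)
    obtain W where W: "W \<in> N" "\<forall>y. y - x \<in> W \<longrightarrow> y \<in> B" using B x by (meson IntD2)
    obtain X where "X \<in> N" "X \<subseteq> V \<inter> W" using directed[OF V(1) W(1)] by (rule bexE)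
    with V(2) W(2) show "\<exists>V\<in>N. \<forall>y. y - x \<in> V \<longrightarrow> y \<in> A \<inter> B"
      by (meson IntD1 IntD2 IntI subsetD)
  next
    fix K x
    assume K: "\<forall>S\<in>K. \<forall>x\<in>S. \<exists>V\<in>N. \<forall>y. y - x \<in> V \<longrightarrow> y \<in> S" and "x \<in> \<Union>K"
    from this(2) obtain S where S: "S \<in> K" "x \<in> S" by (rule UnionE)
    then obtain V where "V \<in> N" "\<forall>y. y - x \<in> V \<longrightarrow> y \<in> S" using K by meson
    with S(1) show "\<exists>V\<in>N. \<forall>y. y - x \<in> V \<longrightarrow> y \<in> \<Union>K" by (meson UnionI)
  qed
  then show ?thesis
    unfolding translation_topology_def by (simp add: topology_inverse')
qed

lemma topspace_eq [simp]: "topspace T = UNIV"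
proof -
  have "openin T UNIV" using nonempty by (auto simp: openin_iff)
  then show ?thesis using openin_subset by blast
qed

lemma open_neighbourhood:
  assumes "V \<in> N"
  obtains U where "openin T U" "x \<in> U" "\<And>y. y \<in> U \<Longrightarrow> y - x \<in> V"
proof
  \<comment> \<open>This is the interior of \<open>x + V\<close>: the points \<open>y\<close> with
    \<open>y + W\<close> inside \<open>x + V\<close> for some \<open>W\<close> in the base. If
    \<open>X + X\<close> lies in \<open>W\<close>, then \<open>z + X\<close> lies in
    \<open>x + V\<close> for each \<open>z\<close> in \<open>y + X\<close>, so the set is
    open.\<close>
  let ?U = "{y. \<exists>W\<in>N. \<forall>w\<in>W. y + w - x \<in> V}"
  show "openin T ?U"
    unfolding openin_iff
  proof
    fix y assume "y \<in> ?U"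
    then obtain W where W: "W \<in> N" "\<forall>w\<in>W. y + w - x \<in> V" by blast
    obtain X where X: "X \<in> N" "\<forall>a\<in>X. \<forall>b\<in>X. a + b \<in> W" using halving W(1) by blast
    have "z \<in> ?U" if "z - y \<in> X" for z
    proof -
      have "z + w - x \<in> V" if "w \<in> X" for w
      proof -
        have "z - y + w \<in> W" using X(2) \<open>z - y \<in> X\<close> that by blast
        with W(2) have "y + (z - y + w) - x \<in> V" by blast
        then show ?thesis by (simp add: algebra_simps)
      qed
      with X(1) show ?thesis by blast
    qed
    with X(1) show "\<exists>V\<in>N. \<forall>z. z - y \<in> V \<longrightarrow> z \<in> ?U" by blast
  qed
  show "x \<in> ?U" using assms by auto
  \<comment> \<open>Take \<open>w = 0\<close> in the condition that defines
    \<open>?U\<close>.\<close>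
  show "y - x \<in> V" if "y \<in> ?U" for y
    using that zero_mem by force
qed

lemma limitin_iff: "limitin T f x F \<longleftrightarrow> (\<forall>V\<in>N. \<forall>\<^sub>F i in F. f i - x \<in> V)"
proof
  assume lim: "limitin T f x F"
  show "\<forall>V\<in>N. \<forall>\<^sub>F i in F. f i - x \<in> V"
  proof
    fix V assume "V \<in> N"
    then obtain U where U: "openin T U" "x \<in> U" "\<And>y. y \<in> U \<Longrightarrow> y - x \<in> V"
      by (rule open_neighbourhood[where x = x]) blast
    with lim have "\<forall>\<^sub>F i in F. f i \<in> U" by (simp add: limitin_def)
    then show "\<forall>\<^sub>F i in F. f i - x \<in> V" by eventually_elim (rule U(3))
  qed
next
  assume ev: "\<forall>V\<in>N. \<forall>\<^sub>F i in F. f i - x \<in> V"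
  show "limitin T f x F"
    unfolding limitin_def
  proof (intro conjI allI impI)
    fix U assume "openin T U \<and> x \<in> U"
    then obtain V where "V \<in> N" "\<forall>y. y - x \<in> V \<longrightarrow> y \<in> U" unfolding openin_iff by blast
    with ev have "\<forall>\<^sub>F i in F. f i - x \<in> V" by blast
    then show "\<forall>\<^sub>F i in F. f i \<in> U"
      by eventually_elim (use \<open>\<forall>y. y - x \<in> V \<longrightarrow> y \<in> U\<close> in blast)
  qed simp
qed

text \<open>A single criterion for all the operations: once \<open>x\<close> is close to
  \<open>a\<close> and \<open>y\<close> to \<open>b\<close>, halving makes the sum of the errors
  small, and solidity passes smallness on to whatever that sum dominates.\<close>

lemma continuous_map_nonexpansive:
  assumes g: "\<And>x y a b. \<bar>g x y - g a b\<bar> \<le> \<bar>x - a\<bar> + \<bar>y - b\<bar>"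
  shows "continuous_map (prod_topology T T) T (\<lambda>(x, y). g x y)"
  unfolding continuous_map_def
proof (intro conjI allI impI)
  fix U assume U: "openin T U"
  have "\<exists>A B. openin T A \<and> openin T B \<and> a \<in> A \<and> b \<in> B \<and> A \<times> B \<subseteq> {(x, y). g x y \<in> U}"
    if gab: "g a b \<in> U" for a b
  proof -
    obtain V where V: "V \<in> N" "\<forall>y. y - g a b \<in> V \<longrightarrow> y \<in> U"
      using bspec[OF U[unfolded openin_iff] gab] by (rule bexE)
    obtain W where W: "W \<in> N" "\<forall>x\<in>W. \<forall>y\<in>W. x + y \<in> V" using halving V(1) by blast
    obtain A where A: "openin T A" "a \<in> A" "\<And>x. x \<in> A \<Longrightarrow> x - a \<in> W"
      using open_neighbourhood W(1) by blast
    obtain B where B: "openin T B" "b \<in> B" "\<And>y. y \<in> B \<Longrightarrow> y - b \<in> W"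
      using open_neighbourhood W(1) by blast
    have "g x y \<in> U" if "x \<in> A" "y \<in> B" for x y
    proof -
      \<comment> \<open>The hypothesis bounds by a sum of absolute values, so these, and not only
        the differences, must lie in \<open>W\<close>; solidity of \<open>W\<close> provides
        that.\<close>
      have "\<bar>x - a\<bar> \<in> W" "\<bar>y - b\<bar> \<in> W"
        using A(3)[OF that(1)] B(3)[OF that(2)] solid[OF W(1)] by (auto intro: solidD)
      with W(2) have "\<bar>x - a\<bar> + \<bar>y - b\<bar> \<in> V" by blast
      moreover have "\<bar>g x y - g a b\<bar> \<le> \<bar>\<bar>x - a\<bar> + \<bar>y - b\<bar>\<bar>"
        using g by (rule order_trans) (rule abs_ge_self)
      ultimately show ?thesis using solidD[OF solid[OF V(1)]] V(2) by blast
    qed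
    with A B show ?thesis by blast
  qed
  then show "openin (prod_topology T T)
      {p \<in> topspace (prod_topology T T). (case p of (x, y) \<Rightarrow> g x y) \<in> U}"
    by (simp add: openin_prod_topology_alt case_prod_unfold del: ex_simps)
qed simp

text \<open>To fit the binary criterion, negation is read as a map of two arguments that ignores the
  second, and is then composed with the diagonal.\<close>

lemma continuous_map_uminus: "continuous_map T T (\<lambda>x. - x)"
proof -
  have "continuous_map (prod_topology T T) T (\<lambda>(x, y). - x)"
    by (rule continuous_map_nonexpansive) (simp add: abs_minus_commute add_increasing2)
  moreover have "continuous_map T (prod_topology T T) (\<lambda>x. (x, x))"
    by (simp add: continuous_map_pairwise o_def)
  ultimately show ?thesis
    using continuous_map_compose[of T "prod_topology T T" "\<lambda>x. (x, x)" T "\<lambda>(x, y). - x"]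
    by (simp add: o_def)
qed

lemma locally_solid: "locally_solid_lgroup T"
  unfolding locally_solid_lgroup_def topological_lgroup_def
proof (intro conjI)
  show "continuous_map (prod_topology T T) T (\<lambda>(x, y). x + y)"
  proof (rule continuous_map_nonexpansive)
    show "\<bar>x + y - (a + b)\<bar> \<le> \<bar>x - a\<bar> + \<bar>y - b\<bar>" for x y a b :: 'a
      using abs_triangle_ineq[of "x - a" "y - b"] by (simp add: algebra_simps)
  qed
  show "neighbourhood_base_at 0 solid T"
    unfolding neighbourhood_base_at_def
  proof (intro allI impI)
    fix U assume "openin T U \<and> 0 \<in> U"
    then obtain V where V: "V \<in> N" "\<forall>y. y - 0 \<in> V \<longrightarrow> y \<in> U" unfolding openin_iff by blast
    obtain A where "openin T A" "0 \<in> A" "\<And>y. y \<in> A \<Longrightarrow> y - 0 \<in> V"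
      using open_neighbourhood V(1) by blast
    moreover from this V(2) have "A \<subseteq> V" "V \<subseteq> U" by auto
    ultimately show "\<exists>A V. openin T A \<and> solid V \<and> 0 \<in> A \<and> A \<subseteq> V \<and> V \<subseteq> U"
      using solid[OF V(1)] by blast
  qed
  show "continuous_map (prod_topology T T) T (\<lambda>(x, y). sup x y)"
    by (rule continuous_map_nonexpansive) (rule abs_sup_diff_le)
  show "continuous_map (prod_topology T T) T (\<lambda>(x, y). inf x y)"
    by (rule continuous_map_nonexpansive) (rule abs_inf_diff_le)
qed (simp_all add: continuous_map_uminus)

lemma Hausdorff:
  assumes sep: "\<And>x. x \<noteq> 0 \<Longrightarrow> \<exists>V\<in>N. x \<notin> V"
  shows "Hausdorff_space T"
  unfolding Hausdorff_space_def
proof (intro allI impI)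
  fix x y assume "x \<in> topspace T \<and> y \<in> topspace T \<and> x \<noteq> y"
  then obtain V where V: "V \<in> N" "x - y \<notin> V" using sep[of "x - y"] by auto
  obtain W where W: "W \<in> N" "\<forall>x\<in>W. \<forall>y\<in>W. x + y \<in> V" using halving V(1) by blast
  obtain A where A: "openin T A" "x \<in> A" "\<And>z. z \<in> A \<Longrightarrow> z - x \<in> W"
    using open_neighbourhood W(1) by blast
  obtain B where B: "openin T B" "y \<in> B" "\<And>z. z \<in> B \<Longrightarrow> z - y \<in> W"
    using open_neighbourhood W(1) by blast
  \<comment> \<open>A common point \<open>z\<close> splits \<open>x - y\<close> as
    \<open>(x - z) + (z - y)\<close> with both terms in \<open>W\<close>, the first by symmetry of
    the solid set \<open>W\<close>. This would put \<open>x - y\<close> into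
    \<open>V\<close>.\<close>
  have False if "z \<in> A" "z \<in> B" for z
  proof -
    have "x - z \<in> W"
      using A(3)[OF that(1)] by (rule solidD[OF solid[OF W(1)]]) (simp add: abs_minus_commute)
    with B(3)[OF that(2)] W(2) have "(x - z) + (z - y) \<in> V" by blast
    with V(2) show False by simp
  qed
  with A B show "\<exists>U V. openin T U \<and> openin T V \<and> x \<in> U \<and> y \<in> V \<and> disjnt U V"
    unfolding disjnt_iff by blast
qed

end

section \<open>Solid neighbourhoods of 0 in the given topology\<close>

definition solid_nbhd :: "'a::lattice_ab_group_add_abs topology \<Rightarrow> 'a set \<Rightarrow> bool" where
  "solid_nbhd T V \<longleftrightarrow> solid V \<and> (\<exists>U. openin T U \<and> 0 \<in> U \<and> U \<subseteq> V)"

lemma solid_nbhd_within: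
  assumes "locally_solid_lgroup T" "openin T U" "0 \<in> U"
  obtains V where "solid_nbhd T V" "V \<subseteq> U"
  using assms
  unfolding locally_solid_lgroup_def neighbourhood_base_at_def solid_nbhd_def by meson

lemma solid_nbhd_Int:
  assumes "solid_nbhd T V" "solid_nbhd T W"
  shows "solid_nbhd T (V \<inter> W)"
proof -
  obtain A B where "openin T A" "0 \<in> A" "A \<subseteq> V" "openin T B" "0 \<in> B" "B \<subseteq> W"
    using assms unfolding solid_nbhd_def by blast
  then have "openin T (A \<inter> B)" "0 \<in> A \<inter> B" "A \<inter> B \<subseteq> V \<inter> W" by auto
  moreover have "solid (V \<inter> W)" using assms unfolding solid_nbhd_def solid_def by blast
  ultimately show ?thesis unfolding solid_nbhd_def by blast
qed

text \<open>Continuity of addition at \<open>(0, 0)\<close> gives an open rectangle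
  \<open>A \<times> B\<close> whose sums stay in \<open>V\<close>; a solid neighbourhood inside
  \<open>A \<inter> B\<close> then works for both summands.\<close>

lemma solid_nbhd_halving:
  assumes T: "locally_solid_lgroup T" and "solid_nbhd T V"
  obtains W where "solid_nbhd T W" "\<And>x y. x \<in> W \<Longrightarrow> y \<in> W \<Longrightarrow> x + y \<in> V"
proof -
  obtain U where U: "openin T U" "0 \<in> U" "U \<subseteq> V"
    using assms(2) unfolding solid_nbhd_def by blast
  have "continuous_map (prod_topology T T) T (\<lambda>(x, y). x + y)" and top: "topspace T = UNIV"
    using T unfolding locally_solid_lgroup_def topological_lgroup_def by auto
  from openin_continuous_map_preimage[OF this(1) U(1)]
  have "openin (prod_topology T T) {(x, y). x + y \<in> U}"
    by (simp add: top case_prod_unfold)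
  moreover have "(0, 0) \<in> {(x, y). x + y \<in> U}" using U(2) by simp
  ultimately obtain A B
    where AB: "openin T A" "openin T B" "0 \<in> A" "0 \<in> B" "A \<times> B \<subseteq> {(x, y). x + y \<in> U}"
    unfolding openin_prod_topology_alt by meson
  then have "openin T (A \<inter> B)" "0 \<in> A \<inter> B" by auto
  with T obtain W where W: "solid_nbhd T W" "W \<subseteq> A \<inter> B" by (rule solid_nbhd_within)
  show thesis
    using W(1) by (rule that) (use W(2) AB(5) U(3) in fast)
qed

text \<open>The limit 0 is the only one required, since \<open>unbounded_limitin\<close> is stated
  through limits at 0.\<close>

lemma limitin_0_iff:
  assumes T: "locally_solid_lgroup T"
  shows "limitin T f 0 F \<longleftrightarrow> (\<forall>V. solid_nbhd T V \<longrightarrow> (\<forall>\<^sub>F i in F. f i \<in> V))"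
proof
  assume lim: "limitin T f 0 F"
  show "\<forall>V. solid_nbhd T V \<longrightarrow> (\<forall>\<^sub>F i in F. f i \<in> V)"
  proof (intro allI impI)
    fix V assume "solid_nbhd T V"
    then obtain U where U: "openin T U" "0 \<in> U" "U \<subseteq> V" unfolding solid_nbhd_def by blast
    with lim have "\<forall>\<^sub>F i in F. f i \<in> U" by (simp add: limitin_def)
    then show "\<forall>\<^sub>F i in F. f i \<in> V" using U(3) by (auto elim: eventually_mono)
  qed
next
  assume ev: "\<forall>V. solid_nbhd T V \<longrightarrow> (\<forall>\<^sub>F i in F. f i \<in> V)"
  have "\<forall>\<^sub>F i in F. f i \<in> U" if U: "openin T U" "0 \<in> U" for U
  proof -
    obtain V where V: "solid_nbhd T V" "V \<subseteq> U" using solid_nbhd_within[OF T U] .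
    from ev V(1) have "\<forall>\<^sub>F i in F. f i \<in> V" by blast
    then show ?thesis by eventually_elim (use V(2) in blast)
  qed
  moreover have "topspace T = UNIV"
    using T unfolding locally_solid_lgroup_def topological_lgroup_def by simp
  ultimately show "limitin T f 0 F" by (simp add: limitin_def)
qed

section \<open>The topology of unbounded convergence\<close>

definition unbounded_base :: "'a::lattice_ab_group_add_abs topology \<Rightarrow> 'a set set" where
  "unbounded_base T = (\<Union>V\<in>{V. solid_nbhd T V}. \<Union>u\<in>{0..}. {{x. inf \<bar>x\<bar> u \<in> V}})"

lemma unbounded_baseI:
  "solid_nbhd T V \<Longrightarrow> 0 \<le> u \<Longrightarrow> {x. inf \<bar>x\<bar> u \<in> V} \<in> unbounded_base T"
  unfolding unbounded_base_def by simp blast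

lemma unbounded_baseE:
  assumes "S \<in> unbounded_base T"
  obtains V u where "solid_nbhd T V" "0 \<le> u" "S = {x. inf \<bar>x\<bar> u \<in> V}"
  using assms unfolding unbounded_base_def by auto

text \<open>Truncations \<open>inf \<bar>x\<bar> u\<close> with \<open>0 \<le> u\<close> are
  nonnegative, so solidity can be applied to them in this form, free of absolute values.\<close>

lemma solid_nbhd_mono:
  assumes "solid_nbhd T V" "b \<in> V" "0 \<le> a" "a \<le> b"
  shows "a \<in> V"
proof -
  have "\<bar>a\<bar> \<le> \<bar>b\<bar>" using assms(3,4) by simp
  then show ?thesis using assms(1,2) solidD unfolding solid_nbhd_def by blast
qed

lemma solid_base_unbounded_base:
  assumes T: "locally_solid_lgroup T"
  shows "solid_base (unbounded_base T)"
proof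
  have "0 \<in> topspace T"
    using T unfolding locally_solid_lgroup_def topological_lgroup_def by simp
  with T openin_topspace obtain V where "solid_nbhd T V" by (rule solid_nbhd_within)
  \<comment> \<open>Here \<open>order_refl\<close> instantiates the bound \<open>u\<close> to
    0.\<close>
  then show "unbounded_base T \<noteq> {}" using unbounded_baseI[OF _ order_refl] by blast
next
  fix S assume "S \<in> unbounded_base T"
  then obtain V u where V: "solid_nbhd T V" and u: "0 \<le> u" and S: "S = {x. inf \<bar>x\<bar> u \<in> V}"
    by (rule unbounded_baseE)
  show "0 \<in> S"
    using V u unfolding S solid_nbhd_def by (auto simp: inf_absorb1)
  show "solid S"
    unfolding solid_def S
  proof clarify
    fix x y assume "\<bar>x\<bar> \<le> \<bar>y\<bar>" "inf \<bar>y\<bar> u \<in> V"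
    then show "inf \<bar>x\<bar> u \<in> V"
      using solid_nbhd_mono[OF V] u by (simp add: le_infI1)
  qed
  show "\<exists>R\<in>unbounded_base T. \<forall>x\<in>R. \<forall>y\<in>R. x + y \<in> S"
  proof -
    obtain W where W: "solid_nbhd T W" "\<And>x y. x \<in> W \<Longrightarrow> y \<in> W \<Longrightarrow> x + y \<in> V"
      by (rule solid_nbhd_halving[OF T V]) blast
    \<comment> \<open>Only the neighbourhood is halved; the bound \<open>u\<close> stays the same,
      because truncation at \<open>u\<close> is subadditive.\<close>
    have "inf \<bar>x + y\<bar> u \<in> V" if "inf \<bar>x\<bar> u \<in> W" "inf \<bar>y\<bar> u \<in> W" for x y
      using W(2)[OF that] by (rule solid_nbhd_mono[OF V]) (simp_all add: u inf_abs_add_le)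
    moreover have "{x. inf \<bar>x\<bar> u \<in> W} \<in> unbounded_base T"
      using W(1) u by (rule unbounded_baseI)
    ultimately show ?thesis unfolding S by (intro bexI) simp_all
  qed
  fix S' assume "S' \<in> unbounded_base T"
  then obtain V' u' where V': "solid_nbhd T V'" and u': "0 \<le> u'" and S': "S' = {x. inf \<bar>x\<bar> u' \<in> V'}"
    by (rule unbounded_baseE)
  \<comment> \<open>The bound \<open>u + u'\<close> dominates both \<open>u\<close> and
    \<open>u'\<close>, so the truncations at \<open>u\<close> and at \<open>u'\<close> lie below the
    one at \<open>u + u'\<close> and inherit its memberships by solidity.\<close>
  let ?R = "{x. inf \<bar>x\<bar> (u + u') \<in> V \<inter> V'}"
  have "?R \<in> unbounded_base T"
    using solid_nbhd_Int[OF V V'] add_nonneg_nonneg[OF u u'] by (rule unbounded_baseI)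
  moreover have "?R \<subseteq> S \<inter> S'"
  proof
    fix x assume x: "x \<in> ?R"
    have "inf \<bar>x\<bar> u \<le> inf \<bar>x\<bar> (u + u')" "inf \<bar>x\<bar> u' \<le> inf \<bar>x\<bar> (u + u')"
      using u u' by (auto intro!: inf_mono simp: add_increasing add_increasing2)
    with x show "x \<in> S \<inter> S'"
      using solid_nbhd_mono[OF V] solid_nbhd_mono[OF V'] u u' unfolding S S' by auto
  qed
  ultimately show "\<exists>R\<in>unbounded_base T. R \<subseteq> S \<inter> S'" by (rule rev_bexI)
qed

text \<open>The filter and its index type are arbitrary, so nets, through \<open>net_filter\<close>,
  and filters on the group itself are both instances.\<close>

lemma limitin_unbounded_topology_iff:
  assumes T: "locally_solid_lgroup T"
  shows "limitin (translation_topology (unbounded_base T)) f x F \<longleftrightarrow> unbounded_limitin T f x F"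
proof -
  have "limitin (translation_topology (unbounded_base T)) f x F \<longleftrightarrow>
      (\<forall>S\<in>unbounded_base T. \<forall>\<^sub>F i in F. f i - x \<in> S)"
    using solid_base_unbounded_base[OF T] by (rule solid_base.limitin_iff)
  \<comment> \<open>Written as an indexed union, the base lets a quantifier over its members unfold
    into quantifiers over \<open>u\<close> and \<open>V\<close>.\<close>
  also have "\<dots> \<longleftrightarrow>
      (\<forall>u\<ge>0. \<forall>V. solid_nbhd T V \<longrightarrow> (\<forall>\<^sub>F i in F. inf \<bar>f i - x\<bar> u \<in> V))"
    unfolding unbounded_base_def by auto
  also have "\<dots> \<longleftrightarrow> unbounded_limitin T f x F"
    unfolding unbounded_limitin_def limitin_0_iff[OF T] ..
  finally show ?thesis .
qed

theorem theorem4: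
  fixes \<tau> :: "'a::lattice_ab_group_add_abs topology"
  assumes "locally_solid_lgroup \<tau>"
    and "\<forall>x. group_bounded \<tau> {x}"
  shows "\<exists>u\<tau>. unbounded_convergence_topology TYPE('i) \<tau> u\<tau> \<and>
           locally_solid_lgroup u\<tau> \<and>
           (Hausdorff_space \<tau> \<longrightarrow> Hausdorff_space u\<tau>)"
proof -
  interpret solid_base "unbounded_base \<tau>"
    using assms(1) by (rule solid_base_unbounded_base)
  have "Hausdorff_space T" if H: "Hausdorff_space \<tau>"
  proof (rule Hausdorff)
    fix x :: 'a assume "x \<noteq> 0"
    then have "0 \<noteq> \<bar>x\<bar>" by simp
    moreover have "topspace \<tau> = UNIV"
      using assms(1) unfolding locally_solid_lgroup_def topological_lgroup_def by simp
    ultimately obtain U where "openin \<tau> U" "0 \<in> U" "\<bar>x\<bar> \<notin> U"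
      using H unfolding Hausdorff_space_def disjnt_iff by (metis UNIV_I)
    then obtain V where "solid_nbhd \<tau> V" "\<bar>x\<bar> \<notin> V"
      using solid_nbhd_within[OF assms(1)] by (metis subsetD)
    \<comment> \<open>Truncating \<open>\<bar>x\<bar>\<close> at \<open>\<bar>x\<bar>\<close> itself
      changes nothing, so \<open>x\<close> fails the membership test exactly because
      \<open>\<bar>x\<bar>\<close> is outside \<open>V\<close>.\<close>
    then have "{y. inf \<bar>y\<bar> \<bar>x\<bar> \<in> V} \<in> unbounded_base \<tau>" "x \<notin> {y. inf \<bar>y\<bar> \<bar>x\<bar> \<in> V}"
      by (simp_all add: unbounded_baseI)
    then show "\<exists>V\<in>unbounded_base \<tau>. x \<notin> V" by (rule rev_bexI)
  qed
  moreover have "unbounded_convergence_topology TYPE('i) \<tau> T"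
    unfolding unbounded_convergence_topology_def
    by (simp add: limitin_unbounded_topology_iff[OF assms(1)])
  ultimately show ?thesis
    using locally_solid by (intro exI[of _ T]) simp
qed

end
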